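(* Let $X\in\mathbb{R}^{n\times m}$ be a real matrix with no zero column, let $0<\lambda<\lambda_{\max}:=\sum_{j\le m}\max_{i\le n}|x_{ij}|$ and let $\delta>0$ be the prescribed precision. The bisection algorithm described in the context, run on input $(X,\lambda,\delta)$, finds $\hat t\in t^*\pm\delta$, i.e. $t^*-\delta\le\hat t\le t^*+\delta$, where $t^*$ is the optimal slack variable.
   Context: $X_j$ denotes the $j$-th column of $X=(x_{ij})$, $\|\cdot\|_1$ is the $\ell_1$ norm on $\mathbb{R}^n$, $\|\cdot\|_F$ is the Frobenius norm, and $[a]^+=\max(a,0)$. $(U^*,t^* )$ is the unique minimizer of $t+\frac{1}{2\lambda}\|U-X\|_F^2$ over $U\in\mathbb{R}^{n\times m}$, $t\ge 0$ subject to $\|U_j\|_1\le t$ for all $j\le m$. Equivalently, $U^*$ is the proximal operator at $X$ of $\lambda$ times the norm $\|U\|_{1,1}=\max_{j\le m}\|U_j\|_1$. The number $t^*$ is called the optimal slack variable. For $t\in[0,\max_j\|X_j\|_1]$ define $I(t)=\{j\le m:\ \|X_j\|_1>t\}$. For $0<t<\max_j\|X_j\|_1$ define $\nu_j(t)=0$ if $j\notin I(t)$, and, if $j\in I(t)$, let $\nu_j(t)$ be the unique $\nu>0$ with $\sum_{i\le n}[|x_{ij}|-\lambda\nu]^+=t$. Algorithm. Inputs: $X$, $\lambda$, precision $\delta$. (1) Sort $|X|$ column-wise in decreasing order and store the output in $Y=(y_{ij})$. (2) Sort the norms $\|X_j\|_1$, $j\le m$, in decreasing order and store the sorted indexes as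 $j_1,\dots,j_m$. (3) If $\lambda\ge\sum_j y_{1j}$, return $U=0$, $t=0$ and $\nu_j=y_{1j}/\lambda$. (4) Initialize $t_{\min}=0$, $t_{\max}=\|X_{j_1}\|_1$, $t=t_{\max}/2$, $\nu_j=0$. While $t_{\max}-t_{\min}>\delta$, do: (5) compute $I(t)$; (6) compute $\nu_j(t)$ for $j\in I(t)$, and set $\nu_j(t)=0$ for all $j\notin I(t)$; (7) if $\sum_{j\le m}\nu_j(t)>1$, set $t_{\min}=t$ and increase $t$ to $(t+t_{\max})/2$; (8) if $\sum_{j\le m}\nu_j(t)<1$, set $t_{\max}=t$ and decrease $t$ to $(t+t_{\min})/2$. The output slack variable $\hat t$ is the final value of $t$.
   Formalization: The loop also stops when the multipliers sum to exactly 1, returning the current t; as literally written, steps (7)-(8) change nothing then and the loop runs forever (e.g. X=1, λ=1/2, δ=1/4), so there would be no final value of t. *)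

theory Defs
  imports "HOL-Analysis.Analysis" "HOL-Library.While_Combinator" "HOL-Library.Multiset"
begin

definition l1_norm :: "real ^ 'n \<Rightarrow> real" where
  "l1_norm v = (\<Sum>i\<in>UNIV. \<bar>v $ i\<bar>)"

text \<open>
  A matrix with \<open>n\<close> rows and \<open>m\<close> columns is an element of \<^typ>\<open>real ^ 'm ^ 'n\<close>. Its library norm,
  the Euclidean norm of the vector of Euclidean norms of the rows, is the Frobenius norm.
\<close>

definition objective :: "real ^ 'm ^ 'n \<Rightarrow> real \<Rightarrow> (real ^ 'm ^ 'n) \<times> real \<Rightarrow> real" where
  "objective X l = (\<lambda>(U, t). t + 1 / (2 * l) * (norm (U - X))\<^sup>2)"

definition feasible :: "(real ^ 'm ^ 'n) \<times> real \<Rightarrow> bool" where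
  "feasible = (\<lambda>(U, t). 0 \<le> t \<and> (\<forall>j. l1_norm (column j U) \<le> t))"

definition optimal_solution :: "real ^ 'm ^ 'n \<Rightarrow> real \<Rightarrow> (real ^ 'm ^ 'n) \<times> real" where
  "optimal_solution X l = (THE s. is_arg_min (objective X l) feasible s)"

definition optimal_slack :: "real ^ 'm ^ 'n \<Rightarrow> real \<Rightarrow> real" where
  "optimal_slack X l = snd (optimal_solution X l)"

definition lambda_max :: "real ^ 'm ^ 'n \<Rightarrow> real" where
  "lambda_max X = (\<Sum>j\<in>UNIV. MAX i\<in>UNIV. \<bar>X $ i $ j\<bar>)"

definition active_columns :: "real ^ 'm ^ 'n \<Rightarrow> real \<Rightarrow> 'm set" where
  "active_columns X t = {j. l1_norm (column j X) > t}"

definition multiplier :: "real ^ 'm ^ 'n \<Rightarrow> real \<Rightarrow> real \<Rightarrow> 'm \<Rightarrow> real" where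
  "multiplier X l t j =
     (if j \<in> active_columns X t
      then THE \<nu>. 0 < \<nu> \<and> (\<Sum>i\<in>UNIV. max (\<bar>X $ i $ j\<bar> - l * \<nu>) 0) = t
      else 0)"

text \<open>The \<open>j\<close>-th column of the sorted matrix \<open>Y\<close>; its head is the entry \<open>y\<^sub>1\<^sub>j\<close>.\<close>

definition sorted_abs_column :: "real ^ 'm ^ 'n \<Rightarrow> 'm \<Rightarrow> real list" where
  "sorted_abs_column X j =
     rev (sorted_list_of_multiset (image_mset (\<lambda>i. \<bar>X $ i $ j\<bar>) (mset_set UNIV)))"

text \<open>Columns with equal norm are listed in an arbitrary order.\<close>

definition sorted_indices :: "real ^ 'm ^ 'n \<Rightarrow> 'm list" where
  "sorted_indices X =
     (SOME js. distinct js \<and> set js = UNIV \<and>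
        sorted_wrt (\<lambda>j k. l1_norm (column k X) \<le> l1_norm (column j X)) js)"

record 'm loop_state =
  lower :: real
  upper :: real
  current :: real
  mults :: "'m \<Rightarrow> real"

definition initial_state :: "real ^ 'm ^ 'n \<Rightarrow> 'm loop_state" where
  "initial_state X =
     (let b = l1_norm (column (hd (sorted_indices X)) X)
      in \<lparr>lower = 0, upper = b, current = b / 2, mults = (\<lambda>j. 0)\<rparr>)"

definition loop_body :: "real ^ 'm ^ 'n \<Rightarrow> real \<Rightarrow> 'm loop_state \<Rightarrow> 'm loop_state" where
  "loop_body X l s =
     (let t = current s; \<nu> = multiplier X l t; s' = s\<lparr>mults := \<nu>\<rparr> in
      if (\<Sum>j\<in>UNIV. \<nu> j) > 1 then s'\<lparr>lower := t, current := (t + upper s) / 2\<rparr>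
      else if (\<Sum>j\<in>UNIV. \<nu> j) < 1 then s'\<lparr>upper := t, current := (t + lower s) / 2\<rparr>
      else s')"

text \<open>
  If the multipliers just computed sum to exactly 1, neither branch of the loop body updates the
  bounds or the current value, and every further pass would repeat the same computation. The
  current value is then final, so the loop also stops in this case. (Before the first pass the
  stored multipliers sum to 0.)
\<close>

definition loop_guard :: "real \<Rightarrow> 'm loop_state \<Rightarrow> bool" where
  "loop_guard \<delta> s \<longleftrightarrow> upper s - lower s > \<delta> \<and> (\<Sum>j\<in>UNIV. mults s j) \<noteq> 1"

datatype ('m, 'n) bisection_output =
    Zero_Solution (solution: "real ^ 'm ^ 'n") (slack: real) (multipliers: "'m \<Rightarrow> real")
  | Bisection_Result (slack: real) (multipliers: "'m \<Rightarrow> real")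

text \<open>The result is \<^term>\<open>None\<close> exactly if the loop does not terminate.\<close>

definition bisection ::
  "real ^ 'm ^ 'n \<Rightarrow> real \<Rightarrow> real \<Rightarrow> ('m, 'n) bisection_output option" where
  "bisection X l \<delta> =
     (let y1 = (\<lambda>j. hd (sorted_abs_column X j)) in
      if l \<ge> (\<Sum>j\<in>UNIV. y1 j) then Some (Zero_Solution 0 0 (\<lambda>j. y1 j / l))
      else map_option (\<lambda>s. Bisection_Result (current s) (mults s))
             (while_option (loop_guard \<delta>) (loop_body X l) (initial_state X)))"

end

theory Submission
  imports Defs
begin

text \<open>
  Write \<open>F\<close> for the objective and \<open>N(t)\<close> for the sum of the multipliers at level \<open>t\<close>. The
  multipliers are Lagrange multipliers of the constraints \<open>\<parallel>U\<^sub>j\<parallel>\<^sub>1 \<le> t\<close>: soft thresholding column \<open>j\<close>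
  of \<open>X\<close> by \<open>\<lambda> \<nu>\<^sub>j(t)\<close> gives a matrix \<open>U\<^sub>t\<close> with \<open>\<parallel>(U\<^sub>t)\<^sub>j\<parallel>\<^sub>1 \<le> t\<close>, with equality wherever
  \<open>\<nu>\<^sub>j(t) > 0\<close>, and soft thresholding minimizes the Lagrangian of its column. Summing over the
  columns yields (\<open>objective_lower_bound\<close>) for every feasible \<open>(U, s)\<close>

  \<open>F(U, s) \<ge> F(U\<^sub>t, t) + (s - t) (1 - N(t))\<close>.

  In other words, \<open>1 - N(t)\<close> is a subgradient at \<open>t\<close> of the value of the problem as a function of
  the slack. Hence its sign tells on which side of \<open>t\<close> the optimal slack lies, and \<open>N(t) = 1\<close> means
  that \<open>t\<close> itself is optimal (\<open>optimal_slack_compare\<close>).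

  Bisection therefore keeps the optimal slack between its two bounds, whose distance halves in each
  pass. It stops either at a point where \<open>N = 1\<close>, which is exact, or with bounds at most \<open>\<delta>\<close> apart
  that enclose both the optimal slack and the current value.
\<close>

section \<open>Soft thresholding\<close>

definition soft_threshold :: "real \<Rightarrow> real \<Rightarrow> real" where
  "soft_threshold a x = sgn x * max (\<bar>x\<bar> - a) 0"

lemma abs_soft_threshold: "0 \<le> a \<Longrightarrow> \<bar>soft_threshold a x\<bar> = max (\<bar>x\<bar> - a) 0"
  by (auto simp: soft_threshold_def abs_mult abs_sgn_eq)

text \<open>
  The soft threshold minimizes \<open>v \<mapsto> (v - x)\<^sup>2 / 2 + a \<bar>v\<bar>\<close>, because \<open>x - u\<close> is a subgradient of
  \<open>a \<bar>\<cdot>\<bar>\<close> at \<open>u\<close>.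
\<close>

lemma soft_threshold_optimal:
  fixes x v a :: real
  assumes "0 \<le> a"
  defines "u \<equiv> soft_threshold a x"
  shows "(u - x)\<^sup>2 + 2 * a * \<bar>u\<bar> \<le> (v - x)\<^sup>2 + 2 * a * \<bar>v\<bar>"
proof -
  have subgradient: "0 \<le> (u - x) * (v - u) + a * (\<bar>v\<bar> - \<bar>u\<bar>)"
  proof -
    consider "\<bar>x\<bar> \<le> a" | "a < x" | "x < - a" by linarith
    then show ?thesis
    proof cases
      case 1
      then have "u = 0" by (simp add: u_def soft_threshold_def)
      moreover have "x * v \<le> a * \<bar>v\<bar>"
        using mult_right_mono[OF 1 abs_ge_zero[of v]] abs_ge_self[of "x * v"]
        by (simp add: abs_mult)
      ultimately show ?thesis by simp
    next
      case 2
      then have u: "u = x - a" using assms by (simp add: u_def soft_threshold_def sgn_if)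
      have "(u - x) * (v - u) + a * (\<bar>v\<bar> - \<bar>u\<bar>) = a * (\<bar>v\<bar> - v)"
        using 2 assms(1) unfolding u by (simp add: algebra_simps)
      then show ?thesis using assms by simp
    next
      case 3
      then have u: "u = x + a" using assms by (simp add: u_def soft_threshold_def sgn_if)
      have "(u - x) * (v - u) + a * (\<bar>v\<bar> - \<bar>u\<bar>) = a * (\<bar>v\<bar> + v)"
        using 3 assms(1) unfolding u by (simp add: algebra_simps)
      moreover have "0 \<le> \<bar>v\<bar> + v" by simp
      ultimately show ?thesis using assms by simp
    qed
  qed
  have "(v - x)\<^sup>2 = (u - x)\<^sup>2 + (v - u)\<^sup>2 + 2 * ((u - x) * (v - u))"
    by (simp add: power2_eq_square algebra_simps)
  moreover have "a * (\<bar>v\<bar> - \<bar>u\<bar>) = a * \<bar>v\<bar> - a * \<bar>u\<bar>"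
    by (rule right_diff_distrib)
  ultimately show ?thesis
    using subgradient zero_le_power2[of "v - u"] by linarith
qed

definition threshold_columns :: "('m \<Rightarrow> real) \<Rightarrow> real ^ 'm ^ 'n \<Rightarrow> real ^ 'm ^ 'n" where
  "threshold_columns a X = (\<chi> i j. soft_threshold (a j) (X $ i $ j))"

lemma l1_norm_threshold_columns:
  fixes X :: "real ^ 'm ^ 'n"
  assumes "0 \<le> a j"
  shows "l1_norm (column j (threshold_columns a X)) = (\<Sum>i\<in>UNIV. max (\<bar>X $ i $ j\<bar> - a j) 0)"
  using assms
  by (simp add: l1_norm_def column_def threshold_columns_def abs_soft_threshold)

lemma norm_matrix_squared:
  fixes A :: "real ^ 'm ^ 'n"
  shows "(norm A)\<^sup>2 = (\<Sum>j\<in>UNIV. \<Sum>i\<in>UNIV. (A $ i $ j)\<^sup>2)"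
  unfolding power2_norm_eq_inner inner_vec_def
  by (subst sum.swap) (simp add: power2_eq_square)

lemma threshold_columns_optimal:
  fixes X V :: "real ^ 'm ^ 'n"
  assumes "\<And>j. 0 \<le> a j"
  defines "U \<equiv> threshold_columns a X"
  shows "(norm (U - X))\<^sup>2 + 2 * (\<Sum>j\<in>UNIV. a j * l1_norm (column j U))
       \<le> (norm (V - X))\<^sup>2 + 2 * (\<Sum>j\<in>UNIV. a j * l1_norm (column j V))"
proof -
  have expand: "(norm (A - X))\<^sup>2 + 2 * (\<Sum>j\<in>UNIV. a j * l1_norm (column j A))
      = (\<Sum>j\<in>UNIV. \<Sum>i\<in>UNIV. (A $ i $ j - X $ i $ j)\<^sup>2 + 2 * a j * \<bar>A $ i $ j\<bar>)"
    for A :: "real ^ 'm ^ 'n"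
    by (simp add: norm_matrix_squared l1_norm_def column_def sum.distrib sum_distrib_left mult.assoc)
  show ?thesis
    unfolding expand U_def threshold_columns_def
    using assms(1) by (auto intro!: sum_mono soft_threshold_optimal)
qed

section \<open>Existence and uniqueness of the minimizer\<close>

lemma column_add_scaleR: "column j (a *\<^sub>R A + b *\<^sub>R B) = a *\<^sub>R column j A + b *\<^sub>R column j B"
  for A B :: "real ^ 'm ^ 'n"
  by (simp add: column_def vec_eq_iff)

lemma l1_norm_convex:
  assumes "0 \<le> a" "0 \<le> b"
  shows "l1_norm (a *\<^sub>R u + b *\<^sub>R v) \<le> a * l1_norm u + b * l1_norm v"
proof -
  have "\<bar>a * u $ i + b * v $ i\<bar> \<le> a * \<bar>u $ i\<bar> + b * \<bar>v $ i\<bar>" for i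
    using assms by (metis abs_mult abs_of_nonneg abs_triangle_ineq)
  then show ?thesis
    by (simp add: l1_norm_def sum_distrib_left flip: sum.distrib) (intro sum_mono, simp)
qed

lemma closed_feasible: "closed {s :: (real ^ 'm ^ 'n) \<times> real. feasible s}"
proof -
  have "{s :: (real ^ 'm ^ 'n) \<times> real. feasible s}
      = {s. 0 \<le> snd s} \<inter> (\<Inter>j. {s. l1_norm (column j (fst s)) \<le> snd s})"
    by (auto simp: feasible_def split: prod.splits)
  also have "closed \<dots>"
    unfolding l1_norm_def column_def
    by (intro closed_Int closed_INT ballI closed_Collect_le)
       (auto intro!: continuous_intros)
  finally show ?thesis .
qed

text \<open>
  The objective at the feasible point \<open>(X, M)\<close>, with \<open>M\<close> the largest column norm, is \<open>M\<close>, so only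
  the compact part of the feasible set with objective at most \<open>M\<close> matters. This also bounds
  the optimal slack.
\<close>

lemma minimizer_exists:
  fixes X :: "real ^ 'm ^ 'n"
  assumes "0 < l" and M: "\<And>j. l1_norm (column j X) \<le> M"
  shows "\<exists>s. is_arg_min (objective X l) feasible s \<and> snd s \<le> M"
proof -
  have "0 \<le> M"
    using M[of undefined] by (rule order_trans[rotated]) (simp add: l1_norm_def sum_nonneg)
  define r where "r = sqrt (2 * l * M)"
  define K where "K = cball X r \<times> {0..M} \<inter> {s. feasible s}"
  have sublevel: "s \<in> K" if "feasible s" "objective X l s \<le> M" for s
  proof -
    obtain U t where s: "s = (U, t)" by (cases s)
    have "0 \<le> t" using that(1) s by (simp add: feasible_def)
    have obj: "t + 1 / (2 * l) * (norm (U - X))\<^sup>2 \<le> M"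
      using that(2) s by (simp add: objective_def)
    have "0 \<le> 1 / (2 * l) * (norm (U - X))\<^sup>2" using assms(1) by simp
    with obj have "t \<le> M" by linarith
    have "1 / (2 * l) * (norm (U - X))\<^sup>2 \<le> M" using obj \<open>0 \<le> t\<close> by linarith
    then have "(norm (U - X))\<^sup>2 \<le> 2 * l * M" using assms(1) by (simp add: field_simps)
    then have "norm (U - X) \<le> r" unfolding r_def by (rule real_le_rsqrt)
    then show ?thesis using \<open>0 \<le> t\<close> \<open>t \<le> M\<close> that(1) s
      by (simp add: K_def dist_norm norm_minus_commute)
  qed
  have XM: "feasible (X, M)" "objective X l (X, M) = M"
    using M \<open>0 \<le> M\<close> by (simp_all add: feasible_def objective_def)
  have "compact K"
    unfolding K_def by (intro compact_Int_closed compact_Times closed_feasible) auto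
  moreover have "K \<noteq> {}" using sublevel[OF XM(1)] XM(2) by auto
  moreover have "continuous_on K (objective X l)"
    unfolding objective_def case_prod_unfold by (intro continuous_intros)
  ultimately obtain s where s: "s \<in> K" "\<And>s'. s' \<in> K \<Longrightarrow> objective X l s \<le> objective X l s'"
    using continuous_attains_inf[of K "objective X l"] by auto
  have "objective X l s \<le> objective X l s'" if "feasible s'" for s'
    using s(2)[of s'] s(2)[of "(X, M)"] sublevel[OF that] sublevel[of "(X, M)"] XM
    by fastforce
  with s(1) show ?thesis
    unfolding is_arg_min_linorder K_def by (intro exI[of _ s]) auto
qed

text \<open>
  At the midpoint of two minimizers, the parallelogram law makes the objective smaller by a
  multiple of \<open>(norm (U - V))\<^sup>2\<close>; so the matrices agree, and then so do the slacks.
\<close>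

lemma minimizer_unique:
  fixes X :: "real ^ 'm ^ 'n"
  assumes "0 < l"
    and s1: "is_arg_min (objective X l) feasible s1"
    and s2: "is_arg_min (objective X l) feasible s2"
  shows "s1 = s2"
proof -
  obtain U t where U: "s1 = (U, t)" by (cases s1)
  obtain V r where V: "s2 = (V, r)" by (cases s2)
  define q where "q = 1 / (2 * l)"
  define W where "W = (1/2) *\<^sub>R U + (1/2) *\<^sub>R V"
  have fU: "feasible (U, t)" and fV: "feasible (V, r)"
    and min1: "\<And>s. feasible s \<Longrightarrow> objective X l (U, t) \<le> objective X l s"
    and min2: "\<And>s. feasible s \<Longrightarrow> objective X l (V, r) \<le> objective X l s"
    using s1 s2 U V by (auto simp: is_arg_min_linorder)
  have "l1_norm (column j W) \<le> (t + r) / 2" for j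
  proof -
    have "l1_norm (column j W) \<le> 1/2 * l1_norm (column j U) + 1/2 * l1_norm (column j V)"
      unfolding W_def column_add_scaleR by (rule l1_norm_convex) auto
    also have "\<dots> \<le> 1/2 * t + 1/2 * r"
      using fU fV by (intro add_mono mult_left_mono) (auto simp: feasible_def)
    finally show ?thesis by simp
  qed
  then have fW: "feasible (W, (t + r) / 2)"
    using fU fV by (auto simp: feasible_def)
  have eq: "t + q * (norm (U - X))\<^sup>2 = r + q * (norm (V - X))\<^sup>2"
    using min1[OF fV] min2[OF fU] by (simp add: objective_def q_def)
  have le: "t + q * (norm (U - X))\<^sup>2
      \<le> (t + r) / 2 + q * (norm (W - X))\<^sup>2"
    using min1[OF fW] by (simp add: objective_def q_def)
  have WX: "W - X = (1/2) *\<^sub>R ((U - X) + (V - X))"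
    by (simp add: W_def vec_eq_iff field_simps)
  have "(norm (A + B))\<^sup>2 + (norm (A - B))\<^sup>2 = 2 * (norm A)\<^sup>2 + 2 * (norm B)\<^sup>2"
    for A B :: "real ^ 'm ^ 'n"
    by (simp add: power2_norm_eq_inner inner_add_left inner_add_right inner_diff_left
        inner_diff_right inner_commute)
  from this[of "U - X" "V - X"] have "4 * (norm (W - X))\<^sup>2 + (norm (U - V))\<^sup>2
      = 2 * (norm (U - X))\<^sup>2 + 2 * (norm (V - X))\<^sup>2"
    unfolding WX by (simp add: power_mult_distrib power_divide)
  then have mid: "(norm (W - X))\<^sup>2
      = (norm (U - X))\<^sup>2 / 2 + (norm (V - X))\<^sup>2 / 2 - (norm (U - V))\<^sup>2 / 4"
    by linarith
  have "q * (norm (W - X))\<^sup>2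
      = q * (norm (U - X))\<^sup>2 / 2 + q * (norm (V - X))\<^sup>2 / 2 - q * (norm (U - V))\<^sup>2 / 4"
    by (simp add: mid algebra_simps)
  moreover have "d \<le> 0"
    if "t + a = r + b" "t + a \<le> (t + r) / 2 + c" "c = a / 2 + b / 2 - d / 4" for a b c d :: real
    using that by (simp add: field_simps)
  ultimately have "q * (norm (U - V))\<^sup>2 \<le> 0" using eq le by blast
  then have "(norm (U - V))\<^sup>2 \<le> 0" using assms(1) by (simp add: q_def field_simps)
  then have "U = V" by simp
  with eq U V show ?thesis by simp
qed

lemma optimal_solution_eqI:
  assumes "0 < l" "is_arg_min (objective X l) feasible s"
  shows "optimal_solution X l = s"
  unfolding optimal_solution_def using assms minimizer_unique by blast

lemma optimal_solution_is_arg_min: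
  assumes "0 < l"
  shows "is_arg_min (objective X l) feasible (optimal_solution X l)"
proof -
  obtain s where "is_arg_min (objective X l) feasible s"
    using minimizer_exists[OF assms, of X "MAX j. l1_norm (column j X)"] by auto
  then show ?thesis using optimal_solution_eqI[OF assms] by metis
qed

lemma optimal_slack_bounds:
  assumes "0 < l" and "\<And>j. l1_norm (column j X) \<le> M"
  shows "0 \<le> optimal_slack X l" "optimal_slack X l \<le> M"
proof -
  show "0 \<le> optimal_slack X l"
    using optimal_solution_is_arg_min[OF assms(1), of X]
    by (auto simp: optimal_slack_def is_arg_min_def feasible_def split: prod.splits)
  obtain s where "is_arg_min (objective X l) feasible s" "snd s \<le> M"
    using minimizer_exists[OF assms] by blast
  then show "optimal_slack X l \<le> M"
    using optimal_solution_eqI[OF assms(1)] by (metis optimal_slack_def)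
qed

section \<open>Multipliers and the position of the optimal slack\<close>

text \<open>
  The thresholded column norm decreases continuously from \<open>\<parallel>X\<^sub>j\<parallel>\<^sub>1\<close> to \<open>0\<close>, and strictly as long as
  it is positive.
\<close>

lemma ex1_multiplier:
  fixes X :: "real ^ 'm ^ 'n"
  assumes "0 < l" "0 < t" "t < l1_norm (column j X)"
  shows "\<exists>!\<nu>. 0 < \<nu> \<and> (\<Sum>i\<in>UNIV. max (\<bar>X $ i $ j\<bar> - l * \<nu>) 0) = t"
proof -
  define S where "S \<nu> = (\<Sum>i\<in>UNIV. max (\<bar>X $ i $ j\<bar> - l * \<nu>) 0)" for \<nu>
  define b where "b = l1_norm (column j X) / l"
  have norm_eq: "l1_norm (column j X) = (\<Sum>i\<in>UNIV. \<bar>X $ i $ j\<bar>)"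
    by (simp add: l1_norm_def column_def)
  have S0: "S 0 = l1_norm (column j X)" by (simp add: S_def norm_eq)
  have "\<bar>X $ i $ j\<bar> \<le> l * b" for i
    using assms(1) member_le_sum[of i UNIV "\<lambda>i. \<bar>X $ i $ j\<bar>"] by (simp add: b_def norm_eq)
  then have Sb: "S b = 0" by (simp add: S_def)
  have "0 \<le> b" using assms by (simp add: b_def)
  moreover have "continuous_on {0..b} S"
    unfolding S_def by (intro continuous_intros)
  ultimately obtain \<nu> where "0 \<le> \<nu>" "S \<nu> = t"
    using IVT2'[of S b t 0] S0 Sb assms by auto
  moreover from this have "\<nu> \<noteq> 0" using S0 assms(3) by auto
  ultimately have ex: "\<exists>\<nu>. 0 < \<nu> \<and> S \<nu> = t" by (intro exI[of _ \<nu>]) auto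
  \<comment> \<open>positivity of \<open>S \<nu>\<close> provides an entry whose summand actually shrinks\<close>
  have strict: "S \<nu>' < S \<nu>" if "\<nu> < \<nu>'" "0 < S \<nu>" for \<nu> \<nu>'
  proof -
    have "\<exists>i. 0 < \<bar>X $ i $ j\<bar> - l * \<nu>"
    proof (rule ccontr)
      assume "\<nexists>i. 0 < \<bar>X $ i $ j\<bar> - l * \<nu>"
      then have "S \<nu> = 0" by (auto simp: S_def not_less max_def intro!: sum.neutral)
      with \<open>0 < S \<nu>\<close> show False by simp
    qed
    then obtain i where i: "0 < \<bar>X $ i $ j\<bar> - l * \<nu>" by blast
    have lt: "l * \<nu> < l * \<nu>'" using assms(1) that(1) by simp
    show ?thesis unfolding S_def
    proof (rule sum_strict_mono_ex1)
      show "\<forall>k\<in>UNIV. max (\<bar>X $ k $ j\<bar> - l * \<nu>') 0 \<le> max (\<bar>X $ k $ j\<bar> - l * \<nu>) 0"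
        using lt by (auto simp: max_def)
      show "\<exists>k\<in>UNIV. max (\<bar>X $ k $ j\<bar> - l * \<nu>') 0 < max (\<bar>X $ k $ j\<bar> - l * \<nu>) 0"
        using lt i by (intro bexI[of _ i]) (auto simp: max_def)
    qed simp
  qed
  have "\<nu> = \<nu>'" if "S \<nu> = t" "S \<nu>' = t" for \<nu> \<nu>'
    using strict[of \<nu> \<nu>'] strict[of \<nu>' \<nu>] that assms(2) by (cases \<nu> \<nu>' rule: linorder_cases) auto
  with ex show ?thesis unfolding S_def by blast
qed

lemma multiplier_active:
  fixes X :: "real ^ 'm ^ 'n"
  assumes "0 < l" "0 < t" "j \<in> active_columns X t"
  shows "0 < multiplier X l t j"
    and "(\<Sum>i\<in>UNIV. max (\<bar>X $ i $ j\<bar> - l * multiplier X l t j) 0) = t"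
  using theI'[OF ex1_multiplier[of l t j X]] assms
  by (auto simp: multiplier_def active_columns_def)

lemma multiplier_nonneg:
  assumes "0 < l" "0 < t"
  shows "0 \<le> multiplier X l t j"
proof (cases "j \<in> active_columns X t")
  case True
  then show ?thesis using multiplier_active(1)[OF assms True] by simp
qed (simp add: multiplier_def)

definition thresholded :: "real ^ 'm ^ 'n \<Rightarrow> real \<Rightarrow> real \<Rightarrow> real ^ 'm ^ 'n" where
  "thresholded X l t = threshold_columns (\<lambda>j. l * multiplier X l t j) X"

lemma l1_norm_thresholded:
  assumes "0 < l" "0 < t"
  shows "l1_norm (column j (thresholded X l t))
       = (if j \<in> active_columns X t then t else l1_norm (column j X))"
  using assms multiplier_active[OF assms, of j X]
  unfolding thresholded_def
  by (subst l1_norm_threshold_columns)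
     (auto simp: multiplier_nonneg multiplier_def l1_norm_def column_def)

lemma feasible_thresholded:
  assumes "0 < l" "0 < t"
  shows "feasible (thresholded X l t, t)"
  using assms by (auto simp: feasible_def l1_norm_thresholded active_columns_def)

text \<open>
  Adding \<open>\<nu>\<^sub>j (\<parallel>U\<^sub>j\<parallel>\<^sub>1 - s) \<le> 0\<close> to the objective turns it into the Lagrangian, whose minimizer is the
  thresholded matrix; complementary slackness evaluates the minimum.
\<close>

lemma objective_lower_bound:
  fixes X U :: "real ^ 'm ^ 'n"
  assumes "0 < l" "0 < t" and "feasible (U, s)"
  shows "objective X l (thresholded X l t, t) + (s - t) * (1 - (\<Sum>j\<in>UNIV. multiplier X l t j))
       \<le> objective X l (U, s)"
proof -
  define \<nu> where "\<nu> = multiplier X l t"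
  define T where "T = thresholded X l t"
  have \<nu>: "0 \<le> \<nu> j" for j using multiplier_nonneg[OF assms(1,2)] by (simp add: \<nu>_def)
  have slackness: "l * \<nu> j * l1_norm (column j T) = l * t * \<nu> j" for j
    using l1_norm_thresholded[OF assms(1,2), of j X] by (auto simp: T_def \<nu>_def multiplier_def)
  have "(norm (T - X))\<^sup>2 + 2 * (\<Sum>j\<in>UNIV. l * \<nu> j * l1_norm (column j T))
      \<le> (norm (U - X))\<^sup>2 + 2 * (\<Sum>j\<in>UNIV. l * \<nu> j * l1_norm (column j U))"
    unfolding T_def thresholded_def \<nu>_def
    using assms multiplier_nonneg[OF assms(1,2), of X]
    by (intro threshold_columns_optimal) (simp add: less_imp_le)
  also have "(\<Sum>j\<in>UNIV. l * \<nu> j * l1_norm (column j T)) = l * t * (\<Sum>j\<in>UNIV. \<nu> j)"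
    by (simp add: slackness sum_distrib_left)
  also have "(\<Sum>j\<in>UNIV. l * \<nu> j * l1_norm (column j U)) \<le> (\<Sum>j\<in>UNIV. l * \<nu> j * s)"
    using assms(1,3) \<nu> by (intro sum_mono mult_left_mono) (auto simp: feasible_def)
  also have "\<dots> = l * s * (\<Sum>j\<in>UNIV. \<nu> j)"
    by (simp add: sum_distrib_left mult_ac)
  finally have "(norm (T - X))\<^sup>2 + 2 * (l * t * (\<Sum>j\<in>UNIV. \<nu> j))
      \<le> (norm (U - X))\<^sup>2 + 2 * (l * s * (\<Sum>j\<in>UNIV. \<nu> j))" by simp
  then have "1 / (2 * l) * ((norm (T - X))\<^sup>2 + 2 * (l * t * (\<Sum>j\<in>UNIV. \<nu> j)))
      \<le> 1 / (2 * l) * ((norm (U - X))\<^sup>2 + 2 * (l * s * (\<Sum>j\<in>UNIV. \<nu> j)))"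
    using assms(1) by (intro mult_left_mono) auto
  then have "1 / (2 * l) * (norm (T - X))\<^sup>2 + t * (\<Sum>j\<in>UNIV. \<nu> j)
      \<le> 1 / (2 * l) * (norm (U - X))\<^sup>2 + s * (\<Sum>j\<in>UNIV. \<nu> j)"
    using assms(1) by (simp add: distrib_left)
  then show ?thesis
    by (simp add: objective_def T_def \<nu>_def algebra_simps)
qed

lemma optimal_slack_compare:
  fixes X :: "real ^ 'm ^ 'n"
  assumes "0 < l" "0 < t"
  defines "N \<equiv> \<Sum>j\<in>UNIV. multiplier X l t j"
  shows "1 < N \<Longrightarrow> t \<le> optimal_slack X l"
    and "N < 1 \<Longrightarrow> optimal_slack X l \<le> t"
    and "N = 1 \<Longrightarrow> optimal_slack X l = t"
proof -
  obtain U s where Us: "optimal_solution X l = (U, s)" by fastforce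
  have opt: "is_arg_min (objective X l) feasible (U, s)"
    using optimal_solution_is_arg_min[OF assms(1), of X] Us by simp
  then have "feasible (U, s)" by (simp add: is_arg_min_def)
  moreover have "objective X l (U, s) \<le> objective X l (thresholded X l t, t)"
    using opt feasible_thresholded[OF assms(1,2), of X] unfolding is_arg_min_linorder by blast
  ultimately have sign: "(s - t) * (1 - N) \<le> 0"
    using objective_lower_bound[OF assms(1,2), of U s X] by (simp add: N_def)
  have slack: "optimal_slack X l = s" by (simp add: optimal_slack_def Us)
  show "1 < N \<Longrightarrow> t \<le> optimal_slack X l" "N < 1 \<Longrightarrow> optimal_slack X l \<le> t"
    using sign slack by (auto simp: mult_le_0_iff)
  assume "N = 1"
  then have "objective X l (thresholded X l t, t) \<le> objective X l p" if "feasible p" for p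
    using objective_lower_bound[OF assms(1,2), of "fst p" "snd p" X] that by (simp add: N_def)
  then have "is_arg_min (objective X l) feasible (thresholded X l t, t)"
    using feasible_thresholded[OF assms(1,2), of X] unfolding is_arg_min_linorder by blast
  then show "optimal_slack X l = t"
    using optimal_solution_eqI[OF assms(1), of X] by (simp add: optimal_slack_def)
qed

section \<open>Bisection\<close>

lemma hd_sorted_abs_column:
  fixes X :: "real ^ 'm ^ 'n"
  shows "hd (sorted_abs_column X j) = (MAX i. \<bar>X $ i $ j\<bar>)"
proof -
  define A where "A = image_mset (\<lambda>i. \<bar>X $ i $ j\<bar>) (mset_set UNIV)"
  define xs where "xs = sorted_list_of_multiset A"
  have set_xs: "set xs = range (\<lambda>i. \<bar>X $ i $ j\<bar>)" by (simp add: xs_def A_def)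
  then have "xs \<noteq> []" by auto
  have "sorted xs" by (simp add: xs_def)
  have "last xs = Max (set xs)"
  proof (rule Max_eqI[symmetric])
    show "x \<le> last xs" if "x \<in> set xs" for x
      using that \<open>sorted xs\<close> \<open>xs \<noteq> []\<close>
      by (auto simp: in_set_conv_nth last_conv_nth intro!: sorted_nth_mono)
  qed (use \<open>xs \<noteq> []\<close> in auto)
  then show ?thesis
    by (simp add: sorted_abs_column_def hd_rev set_xs flip: A_def xs_def)
qed

lemma l1_norm_le_hd_sorted_indices:
  fixes X :: "real ^ 'm ^ 'n"
  shows "l1_norm (column j X) \<le> l1_norm (column (hd (sorted_indices X)) X)"
proof -
  define P where "P js \<longleftrightarrow> distinct js \<and> set js = (UNIV :: 'm set) \<and>
      sorted_wrt (\<lambda>j k. l1_norm (column k X) \<le> l1_norm (column j X)) js" for js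
  obtain xs where xs: "set xs = (UNIV :: 'm set)" "distinct xs"
    using finite_distinct_list[of "UNIV :: 'm set"] by auto
  define js where "js = sort_key (\<lambda>j. - l1_norm (column j X)) xs"
  have "sorted_wrt (\<lambda>j k. l1_norm (column k X) \<le> l1_norm (column j X)) js"
    using sorted_sort_key[of "\<lambda>j. - l1_norm (column j X)" xs]
    by (simp add: js_def sorted_map)
  then have "P js" using xs by (simp add: P_def js_def)
  then have "P (SOME js. P js)" by (rule someI)
  then have "P (sorted_indices X)" by (simp add: sorted_indices_def P_def)
  then have "j \<in> set (sorted_indices X)" by (simp add: P_def)
  then obtain k ks where ks: "sorted_indices X = k # ks" "j = k \<or> j \<in> set ks"
    by (cases "sorted_indices X") auto
  with \<open>P (sorted_indices X)\<close> show ?thesis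
    by (auto simp: P_def)
qed

text \<open>
  The last conjunct records what a stop with multipliers summing to \<open>1\<close> means; the strict
  inequalities keep every level that is tested positive.
\<close>

definition bracket :: "real ^ 'm ^ 'n \<Rightarrow> real \<Rightarrow> 'm loop_state \<Rightarrow> bool" where
  "bracket X l s \<longleftrightarrow> 0 \<le> lower s \<and> lower s < upper s \<and> current s = (lower s + upper s) / 2 \<and>
     lower s \<le> optimal_slack X l \<and> optimal_slack X l \<le> upper s \<and>
     ((\<Sum>j\<in>UNIV. mults s j) = 1 \<longrightarrow> current s = optimal_slack X l)"

lemma bracket_initial_state:
  fixes X :: "real ^ 'm ^ 'n"
  assumes "0 < l" and "\<forall>j. column j X \<noteq> 0"
  shows "bracket X l (initial_state X)"
proof -
  define k where "k = hd (sorted_indices X)"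
  obtain i where "X $ i $ k \<noteq> 0"
    using assms(2) by (auto simp: column_def vec_eq_iff)
  then have "0 < l1_norm (column k X)"
    unfolding l1_norm_def column_def by (intro sum_pos2[of _ i]) auto
  then show ?thesis
    using optimal_slack_bounds[OF assms(1) l1_norm_le_hd_sorted_indices, of X]
    by (simp add: bracket_def initial_state_def Let_def k_def)
qed

lemma bracket_loop_body:
  assumes "0 < l" "bracket X l s"
  shows "bracket X l (loop_body X l s)"
proof -
  have "0 < current s" using assms(2) by (simp add: bracket_def)
  note compare = optimal_slack_compare[OF assms(1) this, of X]
  consider "(\<Sum>j\<in>UNIV. multiplier X l (current s) j) > 1"
    | "(\<Sum>j\<in>UNIV. multiplier X l (current s) j) < 1"
    | "(\<Sum>j\<in>UNIV. multiplier X l (current s) j) = 1" by linarith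
  then show ?thesis
  proof cases
    case 1
    with assms(2) compare(1)[OF 1] show ?thesis by (simp add: bracket_def loop_body_def Let_def)
  next
    case 2
    with assms(2) compare(2)[OF 2] show ?thesis by (simp add: bracket_def loop_body_def Let_def)
  next
    case 3
    with assms(2) compare(3)[OF 3] show ?thesis by (simp add: bracket_def loop_body_def Let_def)
  qed
qed

lemma loop_body_progress:
  assumes "bracket X l s"
  shows "(\<Sum>j\<in>UNIV. mults (loop_body X l s) j) = 1 \<or>
    upper (loop_body X l s) - lower (loop_body X l s) = (upper s - lower s) / 2"
proof -
  have mid: "current s = (lower s + upper s) / 2" using assms by (simp add: bracket_def)
  then have "upper s - current s = (upper s - lower s) / 2"
    and "current s - lower s = (upper s - lower s) / 2" by (simp_all add: field_simps)
  then show ?thesis by (simp add: loop_body_def Let_def)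
qed

text \<open>
  The termination measure bounds the number of remaining passes: \<open>log\<^sub>2 (width / \<delta>)\<close> halvings,
  rounded up, or none once the multipliers sum to \<open>1\<close>. The second case is separate because a pass
  that finds such multipliers leaves the bounds unchanged.
\<close>

lemma bisection_loop_terminates:
  assumes "0 < l" "0 < \<delta>" "bracket X l s\<^sub>0"
  shows "\<exists>s. while_option (loop_guard \<delta>) (loop_body X l) s\<^sub>0 = Some s"
proof (rule measure_while_option_Some[where P = "bracket X l"])
  let ?f = "\<lambda>s. if (\<Sum>j\<in>UNIV. mults s j) = 1 then 0
                else nat \<lceil>log 2 ((upper s - lower s) / \<delta>)\<rceil>"
  fix s assume s: "bracket X l s" "loop_guard \<delta> s"
  let ?s' = "loop_body X l s"
  define c where "c = log 2 ((upper s - lower s) / \<delta>)"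
  have wide: "1 < (upper s - lower s) / \<delta>"
    using s(2) assms(2) by (simp add: loop_guard_def)
  then have "0 < c" by (simp add: c_def)
  have "log 2 ((upper s - lower s) / 2 / \<delta>) = c - 1"
  proof -
    have "(upper s - lower s) / 2 / \<delta> = (upper s - lower s) / \<delta> / 2" by simp
    also have "log 2 \<dots> = c - 1" using wide unfolding c_def by (subst log_divide) auto
    finally show ?thesis .
  qed
  then have "(\<Sum>j\<in>UNIV. mults ?s' j) = 1 \<or>
      nat \<lceil>log 2 ((upper ?s' - lower ?s') / \<delta>)\<rceil> = nat (\<lceil>c\<rceil> - 1)"
    using loop_body_progress[OF s(1)] by (metis ceiling_diff_one)
  moreover have "nat (\<lceil>c\<rceil> - 1) < nat \<lceil>c\<rceil>" using \<open>0 < c\<close> by simp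
  ultimately have "(\<Sum>j\<in>UNIV. mults ?s' j) = 1 \<or>
      nat \<lceil>log 2 ((upper ?s' - lower ?s') / \<delta>)\<rceil> < nat \<lceil>c\<rceil>" by metis
  moreover have "0 < nat \<lceil>c\<rceil>" using \<open>0 < c\<close> by simp
  ultimately have "?f ?s' < ?f s"
    using s(2) by (auto simp: loop_guard_def c_def)
  then show "bracket X l ?s' \<and> ?f ?s' < ?f s"
    using bracket_loop_body[OF assms(1) s(1)] by blast
qed (rule assms(3))

theorem corollary1:
  fixes X :: "real ^ 'm ^ 'n" and l \<delta> :: real
  assumes "\<forall>j. column j X \<noteq> 0"
    and "0 < l" and "l < lambda_max X"
    and "0 < \<delta>"
  shows "\<exists>out. bisection X l \<delta> = Some out \<and>
           optimal_slack X l - \<delta> \<le> slack out \<and> slack out \<le> optimal_slack X l + \<delta>"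
proof -
  have init: "bracket X l (initial_state X)"
    using bracket_initial_state assms by blast
  then obtain s where s:
    "while_option (loop_guard \<delta>) (loop_body X l) (initial_state X) = Some s"
    using bisection_loop_terminates assms by blast
  then have "bisection X l \<delta> = Some (Bisection_Result (current s) (mults s))"
    using assms(3) by (simp add: bisection_def hd_sorted_abs_column lambda_max_def)
  moreover have "bracket X l s"
    using while_option_rule[OF _ s, of "bracket X l"] bracket_loop_body[OF assms(2)] init by blast
  moreover have "\<not> loop_guard \<delta> s" using while_option_stop[OF s] .
  ultimately show ?thesis
    using assms(4) by (auto simp: bracket_def loop_guard_def field_simps)
qed

end
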